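(* Let $d \geq 3$, $p>1$, $s \in (0,1)$ and let $k \in \mathbb{N}$ with $1<k<d$. Let $\alpha, \beta \in \mathbb{R}$ be such that $sp-\alpha-\beta>0$ and $sp \neq k+\alpha+\beta$. Let $K = \{x=(x_k,x_{d-k}) \in \mathbb{R}^k \times \mathbb{R}^{d-k} : x_k = 0\}$. Then there exists a constant $C=C(d,p,s,k,\alpha,\beta)>0$ such that for all $u \in C^1_c(\mathbb{R}^d \setminus K)$, $$\int_{\mathbb{R}^{d}} \frac{|u(x)|^{p}}{|x_{k}|^{sp-\alpha-\beta}}\, dx \leq C \int_{\mathbb{R}^{d}} \int_{\mathbb{R}^{d}} \frac{|u(x)-u(y)|^{p}}{|x-y|^{d+sp}} |x_{k}|^{\alpha} |y_{k}|^{\beta}\, dx\,dy.$$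
   Context: Every $x\in\mathbb{R}^d$ is written $x=(x_k,x_{d-k})$ with $x_k\in\mathbb{R}^k$ and $x_{d-k}\in\mathbb{R}^{d-k}$ (so $x_k$ denotes the block of the first $k$ coordinates, not a single coordinate); likewise $y=(y_k,y_{d-k})$. $C^1_c(\mathbb{R}^d\setminus K)$ is the space of real-valued $C^1$ functions with compact support contained in $\mathbb{R}^d\setminus K$, extended by zero to $\mathbb{R}^d$. *)

theory Defs
  imports "HOL-Analysis.Analysis"
begin

text \<open>
  \<open>R\<^sup>d\<close> is the product type \<open>(real ^ 'k) \<times> (real ^ 'm)\<close> with \<open>CARD('k) = k\<close> and \<open>CARD('m) = d - k\<close>, 
  so \<open>x\<^sub>k = fst x\<close> and \<open>x\<^bsub>d-k\<^esub> = snd x\<close>. The library norm on products is the Euclidean one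
  (\<^emph>\<open>norm_Pair\<close>), and \<open>lborel\<close> on products is the product Lebesgue measure (\<^emph>\<open>lborel_prod\<close>).
\<close>

definition singular_set :: "('a::zero \<times> 'b) set" where
  "singular_set = {x. fst x = 0}"

definition support :: "('a::topological_space \<Rightarrow> real) \<Rightarrow> 'a set" where
  "support u = closure {x. u x \<noteq> 0}"

text \<open>
  Members of \<open>C\<^sup>1\<^sub>c(\<Omega>)\<close> for open \<open>\<Omega>\<close>, as functions on the whole space: the support condition makes them
  vanish outside \<open>\<Omega>\<close>, which is the extension by zero. Continuity of the derivative is with respect
  to the operator norm.
\<close>

definition C1c :: "'a::euclidean_space set \<Rightarrow> ('a \<Rightarrow> real) set" where
  "C1c \<Omega> = {u.
     (\<exists>u' :: 'a \<Rightarrow> 'a \<Rightarrow>\<^sub>L real.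
        (\<forall>x\<in>\<Omega>. (u has_derivative blinfun_apply (u' x)) (at x)) \<and> continuous_on \<Omega> u') \<and>
     compact (support u) \<and> support u \<subseteq> \<Omega>}"

end

theory Submission imports Defs begin

text \<open>
  Write \<open>\<gamma> = sp - \<alpha> - \<beta>\<close> and compare \<open>u(x)\<close> with the values \<open>u(y)\<close> for \<open>y\<close> in a region
  \<open>N(x)\<close> of diameter comparable to \<open>|x\<^sub>k|\<close> on which \<open>|y\<^sub>k|\<close> is about \<open>\<lambda> |x\<^sub>k|\<close>. Integrating
  \<open>|u(x)|\<^sup>p \<le> 2\<^sup>p (|u(x) - u(y)|\<^sup>p + |u(y)|\<^sup>p)\<close> against \<open>|x\<^sub>k|\<close> to the power \<open>-\<gamma>-d\<close> over \<open>y \<in> N(x)\<close>,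
  the difference term is dominated by the Gagliardo kernel, and by Tonelli the last term is at
  most a constant times \<open>\<lambda>\<close> to the power \<open>\<gamma>-k\<close> times the left hand side, relative to the
  volume of \<open>N(x)\<close>. As \<open>\<gamma> \<noteq> k\<close>, a large or a small \<open>\<lambda>\<close> makes this factor \<open>1/2\<close>, and the term is
  absorbed because the left hand side is finite.
\<close>

section \<open>Elementary inequalities for real powers\<close>

lemma abs_powr_le_diff:
  fixes a b p :: real
  assumes "p \<ge> 0"
  shows "\<bar>a\<bar> powr p \<le> 2 powr p * (\<bar>a - b\<bar> powr p + \<bar>b\<bar> powr p)"
proof -
  have "\<bar>a\<bar> powr p \<le> (2 * max \<bar>a - b\<bar> \<bar>b\<bar>) powr p"
    using assms abs_triangle_ineq[of "a - b" b] by (intro powr_mono2) (auto simp: max_def)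
  also have "\<dots> = 2 powr p * max \<bar>a - b\<bar> \<bar>b\<bar> powr p"
    by (simp add: powr_mult)
  also have "\<dots> \<le> 2 powr p * (\<bar>a - b\<bar> powr p + \<bar>b\<bar> powr p)"
    by (intro mult_left_mono) (auto simp: max_def)
  finally show ?thesis .
qed

text \<open>The minimum of the endpoint values treats increasing and decreasing powers at once,
  since \<beta> may have either sign.\<close>

lemma powr_between:
  fixes a b x t :: real
  assumes "0 < a" "a \<le> x" "x \<le> b"
  shows "min (a powr t) (b powr t) \<le> x powr t"
proof (cases "t \<ge> 0")
  case True
  then have "a powr t \<le> x powr t" using assms by (intro powr_mono2) auto
  then show ?thesis by simp
next
  case False
  then have "b powr t \<le> x powr t" using assms by (intro powr_mono2') auto
  then show ?thesis by simp
qed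

section \<open>The comparison region and the volumes of its sections\<close>

lemma emeasure_annulus:
  fixes r :: real
  assumes "r \<ge> 0"
  shows "emeasure lborel {v::'a::euclidean_space. r < norm v \<and> norm v \<le> 2 * r} =
    ennreal (unit_ball_vol (real DIM('a)) * (2 ^ DIM('a) - 1) * r ^ DIM('a))"
proof -
  have eq: "{v::'a. r < norm v \<and> norm v \<le> 2 * r} = cball 0 (2 * r) - cball 0 r"
    by auto
  have "emeasure lborel (cball (0::'a) (2 * r) - cball 0 r) =
      emeasure lborel (cball (0::'a) (2 * r)) - emeasure lborel (cball (0::'a) r)"
    using assms by (intro emeasure_Diff) (auto simp: emeasure_cball)
  also have "\<dots> = ennreal (unit_ball_vol (real DIM('a)) * (2 * r) ^ DIM('a)
      - unit_ball_vol (real DIM('a)) * r ^ DIM('a))"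
    using assms by (subst ennreal_minus[symmetric]) (auto simp: emeasure_cball)
  finally show ?thesis
    unfolding eq by (simp add: power_mult_distrib algebra_simps)
qed

text \<open>This is N(x), kept as a set of pairs so that it can be sliced in either variable. The
  strict lower bound excludes \<open>fst x = 0\<close>, so on the region powers of
  \<open>norm (fst x)\<close> are taken at positive values only.\<close>

definition comparison_region ::
  "real \<Rightarrow> (('a::euclidean_space \<times> 'b::euclidean_space) \<times> ('a \<times> 'b)) set" where
  "comparison_region l = {(x, y). l * norm (fst x) < norm (fst y) \<and>
     norm (fst y) \<le> 2 * (l * norm (fst x)) \<and> dist (snd x) (snd y) \<le> norm (fst x)}"

lemma borel_measurable_norm_fst [measurable]:
  fixes f :: "'c \<Rightarrow> 'a::euclidean_space \<times> 'b::euclidean_space"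
  assumes [measurable]: "f \<in> borel_measurable M"
  shows "(\<lambda>x. norm (fst (f x))) \<in> borel_measurable M"
proof -
  have "(\<lambda>y::'a \<times> 'b. norm (fst y)) \<in> borel_measurable borel"
    by (intro borel_measurable_continuous_onI continuous_intros)
  then show ?thesis
    using assms by (rule measurable_compose_rev)
qed

lemma comparison_region_measurable [measurable]: "comparison_region l \<in> sets borel"
proof -
  let ?x = "\<lambda>z::('a \<times> 'b) \<times> ('a \<times> 'b). norm (fst (fst z))"
  let ?y = "\<lambda>z::('a \<times> 'b) \<times> ('a \<times> 'b). norm (fst (snd z))"
  let ?d = "\<lambda>z::('a \<times> 'b) \<times> ('a \<times> 'b). dist (snd (fst z)) (snd (snd z))"
  have "comparison_region l =
      {z. l * ?x z < ?y z} \<inter> {z. ?y z \<le> 2 * (l * ?x z)} \<inter> {z. ?d z \<le> ?x z}"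
    by (auto simp: comparison_region_def)
  also have "\<dots> \<in> sets borel"
    by (intro sets.Int borel_open borel_closed open_Collect_less closed_Collect_le continuous_intros)
  finally show ?thesis .
qed

lemma comparison_region_sections_measurable [measurable]:
  "{y. (x, y) \<in> comparison_region l} \<in> sets borel"
  "{x. (x, y) \<in> comparison_region l} \<in> sets borel"
proof -
  have "(\<lambda>y. (x, y)) -` comparison_region l \<in> sets borel"
    "(\<lambda>x. (x, y)) -` comparison_region l \<in> sets borel"
    by (intro measurable_sets_borel[OF _ comparison_region_measurable]
        borel_measurable_continuous_onI continuous_intros)+
  then show "{y. (x, y) \<in> comparison_region l} \<in> sets borel"
    "{x. (x, y) \<in> comparison_region l} \<in> sets borel"
    by (simp_all add: vimage_def)
qed

lemma comparison_region_pos: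
  assumes "(x, y) \<in> comparison_region l" "l > 0"
  shows "norm (fst x) > 0" "norm (fst y) > 0"
proof -
  have "l * norm (fst x) < norm (fst y)" "norm (fst y) \<le> 2 * (l * norm (fst x))"
    using assms by (auto simp: comparison_region_def)
  \<comment> \<open>The two bounds together say that \<open>l * norm (fst x)\<close> is smaller than
    its double.\<close>
  then have "l * norm (fst x) > 0" by linarith
  with assms show "norm (fst x) > 0" by (simp add: zero_less_mult_iff)
  show "norm (fst y) > 0"
    using \<open>l * norm (fst x) > 0\<close> \<open>l * norm (fst x) < norm (fst y)\<close> by linarith
qed

text \<open>The section is an annulus in the first block times a ball in the second. Only the
  annulus scales with \<open>l\<close>, hence the exponent k of \<open>l\<close>, while both factors
  contribute to the exponent d of \<open>norm (fst x)\<close>.\<close>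

lemma emeasure_comparison_region_section:
  fixes x :: "'a::euclidean_space \<times> 'b::euclidean_space"
  assumes "l > 0"
  shows "emeasure lborel {y. (x, y) \<in> comparison_region l} =
    ennreal (unit_ball_vol (real DIM('a)) * unit_ball_vol (real DIM('b)) * (2 ^ DIM('a) - 1) *
      l ^ DIM('a) * norm (fst x) ^ DIM('a \<times> 'b))"
proof -
  let ?r = "norm (fst x)"
  let ?A = "{v::'a. l * ?r < norm v \<and> norm v \<le> 2 * (l * ?r)}"
  have eq: "{y. (x, y) \<in> comparison_region l} = ?A \<times> cball (snd x) ?r"
    by (auto simp: comparison_region_def)
  have "emeasure lborel (?A \<times> cball (snd x) ?r) =
      emeasure lborel ?A * emeasure lborel (cball (snd x) ?r)"
    unfolding lborel_prod[symmetric] by (intro lborel.emeasure_pair_measure_Times) auto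
  also have "\<dots> = ennreal (unit_ball_vol (real DIM('a)) * (2 ^ DIM('a) - 1) * (l * ?r) ^ DIM('a))
      * ennreal (unit_ball_vol (real DIM('b)) * ?r ^ DIM('b))"
    using assms by (subst emeasure_annulus) (auto simp: emeasure_cball)
  also have "\<dots> = ennreal (unit_ball_vol (real DIM('a)) * unit_ball_vol (real DIM('b)) *
      (2 ^ DIM('a) - 1) * l ^ DIM('a) * ?r ^ DIM('a \<times> 'b))"
    using assms by (subst ennreal_mult[symmetric]) (auto simp: power_mult_distrib power_add mult_ac)
  finally show ?thesis unfolding eq .
qed

text \<open>Membership forces \<open>norm (fst x) < norm (fst y) / l\<close>, which in turn bounds
  the distance of the second blocks, so both blocks of x lie in balls of that radius.\<close>

lemma emeasure_comparison_region_dual_section_le: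
  fixes y :: "'a::euclidean_space \<times> 'b::euclidean_space"
  assumes "l > 0"
  shows "emeasure lborel {x. (x, y) \<in> comparison_region l} \<le>
    ennreal (unit_ball_vol (real DIM('a)) * unit_ball_vol (real DIM('b)) *
      (norm (fst y) / l) ^ DIM('a \<times> 'b))"
proof -
  let ?r = "norm (fst y) / l"
  have "{x. (x, y) \<in> comparison_region l} \<subseteq> cball 0 ?r \<times> cball (snd y) ?r"
  proof
    fix x assume "x \<in> {x. (x, y) \<in> comparison_region l}"
    then have *: "norm (fst x) < ?r" "dist (snd x) (snd y) \<le> norm (fst x)"
      using assms by (auto simp: comparison_region_def field_simps)
    then show "x \<in> cball 0 ?r \<times> cball (snd y) ?r"
      by (cases x) (auto simp: dist_commute)
  qed
  then have "emeasure lborel {x. (x, y) \<in> comparison_region l} \<le>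
      emeasure lborel (cball (0::'a) ?r \<times> cball (snd y) ?r)"
    by (intro emeasure_mono) (auto intro!: borel_closed closed_Times)
  also have "\<dots> = emeasure lborel (cball (0::'a) ?r) * emeasure lborel (cball (snd y) ?r)"
    unfolding lborel_prod[symmetric] by (intro lborel.emeasure_pair_measure_Times) auto
  also have "\<dots> = ennreal (unit_ball_vol (real DIM('a)) * unit_ball_vol (real DIM('b)) *
      ?r ^ DIM('a \<times> 'b))"
    using assms by (subst (1 2) emeasure_cball, simp, simp, subst ennreal_mult[symmetric])
      (auto simp: power_add algebra_simps)
  finally show ?thesis .
qed

section \<open>The comparison kernel: integrals in each variable and domination by the Gagliardo
  kernel\<close>

text \<open>The dimension in the exponent offsets the volume of a section, so that integration in
  either variable leaves a power with exponent \<open>- g\<close>.\<close>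

definition comparison_kernel ::
  "real \<Rightarrow> real \<Rightarrow> 'a::euclidean_space \<times> 'b::euclidean_space \<Rightarrow> 'a \<times> 'b \<Rightarrow> real" where
  "comparison_kernel l g x y = indicator (comparison_region l) (x, y) *
     norm (fst x) powr (- g - real DIM('a \<times> 'b))"

lemma comparison_kernel_nonneg: "comparison_kernel l g x y \<ge> 0"
  by (simp add: comparison_kernel_def)

lemma comparison_kernel_measurable [measurable]:
  "(\<lambda>z. comparison_kernel l g (fst z) (snd z)) \<in> borel_measurable (borel \<Otimes>\<^sub>M borel)"
proof -
  have [measurable]: "(comparison_region l :: (('a \<times> 'b) \<times> ('a \<times> 'b)) set)
      \<in> sets (borel \<Otimes>\<^sub>M borel)"
    unfolding borel_prod by (rule comparison_region_measurable)
  show ?thesis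
    unfolding comparison_kernel_def prod.collapse by measurable
qed

lemma nn_integral_comparison_kernel:
  fixes x :: "'a::euclidean_space \<times> 'b::euclidean_space"
  assumes "l > 0" "fst x \<noteq> 0"
  shows "(\<integral>\<^sup>+ y. ennreal (comparison_kernel l g x y) \<partial>lborel) =
    ennreal (unit_ball_vol (real DIM('a)) * unit_ball_vol (real DIM('b)) * (2 ^ DIM('a) - 1) *
      l ^ DIM('a)) * ennreal (norm (fst x) powr - g)"
proof -
  let ?n = "DIM('a \<times> 'b)"
  have "(\<integral>\<^sup>+ y. ennreal (comparison_kernel l g x y) \<partial>lborel) =
      (\<integral>\<^sup>+ y. ennreal (norm (fst x) powr (- g - real ?n)) *
        indicator {y. (x, y) \<in> comparison_region l} y \<partial>lborel)"
    by (intro nn_integral_cong) (auto simp: comparison_kernel_def indicator_def)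
  also have "\<dots> = ennreal (norm (fst x) powr (- g - real ?n)) *
      emeasure lborel {y. (x, y) \<in> comparison_region l}"
    by (intro nn_integral_cmult_indicator) auto
  also have "\<dots> = ennreal (unit_ball_vol (real DIM('a)) * unit_ball_vol (real DIM('b)) *
      (2 ^ DIM('a) - 1) * l ^ DIM('a) * (norm (fst x) powr (- g - real ?n) * norm (fst x) ^ ?n))"
    using assms by (subst emeasure_comparison_region_section)
      (auto simp: mult_ac simp flip: ennreal_mult)
  also have "norm (fst x) powr (- g - real ?n) * norm (fst x) ^ ?n = norm (fst x) powr - g"
    using assms by (subst powr_realpow[symmetric]) (auto simp flip: powr_add)
  finally show ?thesis
    using assms by (simp add: ennreal_mult)
qed

text \<open>On the region \<open>norm (fst x)\<close> is at least
  \<open>norm (fst y) / (2 * l)\<close>, which bounds the kernel because its exponent is negative.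
  With the volume bound the exponents of \<open>l\<close> add up to (g + d) - d = g, against k for
  the integral in y; this gap drives the proof.\<close>

lemma nn_integral_comparison_kernel_dual_le:
  fixes y :: "'a::euclidean_space \<times> 'b::euclidean_space"
  assumes "l > 0" "g > 0"
  shows "(\<integral>\<^sup>+ x. ennreal (comparison_kernel l g x y) \<partial>lborel) \<le>
    ennreal (unit_ball_vol (real DIM('a)) * unit_ball_vol (real DIM('b)) *
      2 powr (g + real DIM('a \<times> 'b)) * l powr g) * ennreal (norm (fst y) powr - g)"
proof -
  let ?n = "DIM('a \<times> 'b)" and ?r = "norm (fst y)"
  let ?N = "{x. (x, y) \<in> comparison_region l}"
  show ?thesis
  proof (cases "fst y = 0")
    case True
    \<comment> \<open>With an empty section the integral is 0, matching the right hand side, where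
      \<open>0 powr - g = 0\<close>.\<close>
    then have "?N = {}"
      using comparison_region_pos(2)[OF _ assms(1)] by fastforce
    then have "(x, y) \<notin> comparison_region l" for x by blast
    then show ?thesis by (simp add: comparison_kernel_def)
  next
    case False
    then have r: "?r > 0" by simp
    have "(\<integral>\<^sup>+ x. ennreal (comparison_kernel l g x y) \<partial>lborel) \<le>
        (\<integral>\<^sup>+ x. ennreal ((?r / (2 * l)) powr (- g - real ?n)) * indicator ?N x \<partial>lborel)"
    proof (intro nn_integral_mono)
      fix x
      have "norm (fst x) powr (- g - real ?n) \<le> (?r / (2 * l)) powr (- g - real ?n)"
        if "(x, y) \<in> comparison_region l"
      proof (intro powr_mono2')
        show "- g - real ?n \<le> 0" "?r / (2 * l) > 0" using assms r by auto
        show "?r / (2 * l) \<le> norm (fst x)"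
          using that assms by (auto simp: comparison_region_def field_simps)
      qed
      then show "ennreal (comparison_kernel l g x y) \<le>
          ennreal ((?r / (2 * l)) powr (- g - real ?n)) * indicator ?N x"
        by (auto simp: comparison_kernel_def indicator_def intro!: ennreal_leI)
    qed
    also have "\<dots> = ennreal ((?r / (2 * l)) powr (- g - real ?n)) * emeasure lborel ?N"
      by (intro nn_integral_cmult_indicator) auto
    also have "\<dots> \<le> ennreal ((?r / (2 * l)) powr (- g - real ?n)) *
        ennreal (unit_ball_vol (real DIM('a)) * unit_ball_vol (real DIM('b)) * (?r / l) ^ ?n)"
      using assms by (intro mult_left_mono emeasure_comparison_region_dual_section_le) auto
    also have "\<dots> = ennreal (unit_ball_vol (real DIM('a)) * unit_ball_vol (real DIM('b)) *
        ((?r / (2 * l)) powr (- g - real ?n) * (?r / l) powr real ?n))"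
      using assms r by (subst powr_realpow) (auto simp: mult_ac simp flip: ennreal_mult)
    also have "(?r / (2 * l)) powr (- g - real ?n) * (?r / l) powr real ?n =
        2 powr (g + real ?n) * l powr g * ?r powr - g"
    proof -
      \<comment> \<open>Splitting off 1/2 leaves the common base \<open>?r / l\<close>, whose
        exponents -g - d and d add up to -g.\<close>
      have "?r / (2 * l) = (?r / l) * inverse 2"
        by (simp add: field_simps)
      then have "(?r / (2 * l)) powr (- g - real ?n) =
          (?r / l) powr (- g - real ?n) * inverse 2 powr (- g - real ?n)"
        by (simp only: powr_mult)
      also have "inverse (2::real) powr (- g - real ?n) = 2 powr (g + real ?n)"
        by (subst inverse_powr[of 2]) (simp_all add: add_ac flip: powr_minus)
      finally have "(?r / (2 * l)) powr (- g - real ?n) * (?r / l) powr real ?n =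
          2 powr (g + real ?n) * ((?r / l) powr (- g - real ?n) * (?r / l) powr real ?n)"
        by simp
      also have "(?r / l) powr (- g - real ?n) * (?r / l) powr real ?n = (?r / l) powr - g"
        by (simp flip: powr_add)
      also have "\<dots> = l powr g * ?r powr - g"
        using assms r by (simp add: powr_divide powr_minus field_simps)
      finally show ?thesis by simp
    qed
    finally show ?thesis
      using assms by (simp add: ennreal_mult mult_ac)
  qed
qed

text \<open>On the region \<open>norm (x - y)\<close> is at most a multiple of
  \<open>norm (fst x)\<close>, and \<open>norm (fst y)\<close> is comparable to it. The Gagliardo
  kernel with its weights is thus bounded below by a multiple of \<open>norm (fst x)\<close> to the
  power -(d + t) + \<alpha> + \<beta>, the exponent in the comparison kernel.\<close>

lemma comparison_kernel_le_gagliardo: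
  fixes x y :: "'a::euclidean_space \<times> 'b::euclidean_space" and u :: "'a \<times> 'b \<Rightarrow> real"
  assumes "l > 0" "t > 0"
  shows "comparison_kernel l (t - \<alpha> - \<beta>) x y * \<bar>u x - u y\<bar> powr p \<le>
    (2 + 2 * l) powr (real DIM('a \<times> 'b) + t) / min (l powr \<beta>) ((2 * l) powr \<beta>) *
      (\<bar>u x - u y\<bar> powr p / norm (x - y) powr (real DIM('a \<times> 'b) + t) *
        norm (fst x) powr \<alpha> * norm (fst y) powr \<beta>)"
    (is "?L \<le> ?c / ?m * ?R")
proof (cases "(x, y) \<in> comparison_region l \<and> x \<noteq> y")
  case False
  \<comment> \<open>Off the region the indicator vanishes; for x = y the difference does, and
    \<open>0 powr p = 0\<close>.\<close>
  then have "?L = 0"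
    by (auto simp: comparison_kernel_def)
  moreover have "0 \<le> ?c / ?m * ?R"
    by (intro mult_nonneg_nonneg divide_nonneg_nonneg) auto
  ultimately show ?thesis by (rule ord_eq_le_trans)
next
  case True
  let ?n = "real DIM('a \<times> 'b)" and ?r = "norm (fst x)"
  let ?q = "\<bar>u x - u y\<bar> powr p"
  have r: "?r > 0" using True comparison_region_pos assms by blast
  have b: "l * ?r \<le> norm (fst y)" "norm (fst y) \<le> 2 * l * ?r"
      "dist (snd x) (snd y) \<le> ?r"
    using True by (auto simp: comparison_region_def)
  have m: "?m > 0" using assms by auto
  have D: "norm (x - y) > 0" using True by simp
  \<comment> \<open>The first blocks differ by at most (1 + 2l)\<open>?r\<close> and the second by
    at most \<open>?r\<close>, which gives the constant 2 + 2l.\<close>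
  have "norm (x - y) \<le> norm (fst (x - y)) + norm (snd (x - y))"
    using norm_Pair_le[of "fst (x - y)" "snd (x - y)"] by (simp only: prod.collapse)
  also have "\<dots> \<le> (?r + norm (fst y)) + ?r"
    using b(3) norm_triangle_ineq4[of "fst x" "fst y"] by (simp add: dist_norm)
  also have "\<dots> \<le> (2 + 2 * l) * ?r" using b by (simp add: algebra_simps)
  finally have "norm (x - y) powr (?n + t) \<le> ((2 + 2 * l) * ?r) powr (?n + t)"
    using assms by (intro powr_mono2) auto
  also have "\<dots> = ?c * ?r powr (?n + t)"
    by (rule powr_mult)
  finally have 1: "1 \<le> ?c * ?r powr (?n + t) / norm (x - y) powr (?n + t)"
    using D by (simp add: field_simps)
  have "min ((l * ?r) powr \<beta>) ((2 * l * ?r) powr \<beta>) \<le> norm (fst y) powr \<beta>"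
    using assms r b by (intro powr_between) auto
  moreover have "min ((l * ?r) powr \<beta>) ((2 * l * ?r) powr \<beta>) = ?m * ?r powr \<beta>"
    using assms r by (simp add: powr_mult min_mult_distrib_right)
  ultimately have 2: "?r powr \<beta> \<le> norm (fst y) powr \<beta> / ?m"
    using m by (simp add: pos_le_divide_eq mult.commute)
  have "?L = ?r powr (- ?n - t + \<alpha> + \<beta>) * ?q"
    using True by (simp add: comparison_kernel_def algebra_simps)
  \<comment> \<open>The factors \<open>?r powr \<beta>\<close> and 1 are isolated so that the bounds
    2 and 1 can replace them.\<close>
  also have "\<dots> = ?r powr (- (?n + t)) * ?r powr \<alpha> * ?r powr \<beta> * ?q * 1"
    by (simp add: algebra_simps flip: powr_add)
  also have "\<dots> \<le> ?r powr (- (?n + t)) * ?r powr \<alpha> * (norm (fst y) powr \<beta> / ?m) * ?q *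
      (?c * ?r powr (?n + t) / norm (x - y) powr (?n + t))"
    using m by (intro mult_mono mult_nonneg_nonneg 1 2) auto
  also have "\<dots> = (?r powr (- (?n + t)) * ?r powr (?n + t)) * (?c / ?m * ?R)"
    by (simp add: field_simps)
  also have "?r powr (- (?n + t)) * ?r powr (?n + t) = 1"
    using r by (simp flip: powr_add)
  finally show ?thesis by simp
qed

section \<open>Test functions: continuity and finiteness of the Hardy integral\<close>

lemma C1c_imp_continuous_on:
  assumes "u \<in> C1c S" "open S"
  shows "continuous_on UNIV u"
proof -
  from assms obtain u' where
    d: "\<forall>x\<in>S. (u has_derivative blinfun_apply (u' x)) (at x)" and
    s: "compact (support u)" "support u \<subseteq> S"
    unfolding C1c_def by blast
  have 1: "continuous_on S u"
    using d by (meson continuous_at_imp_continuous_on has_derivative_continuous)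
  have z: "u x = 0" if "x \<in> - support u" for x
    using that closure_subset[of "{x. u x \<noteq> 0}"] unfolding support_def by blast
  have 2: "continuous_on (- support u) u"
    by (rule continuous_on_eq[of _ "\<lambda>_. 0"]) (auto simp: z)
  have "open (- support u)"
    using s compact_imp_closed by blast
  \<comment> \<open>Differentiability is known on S only; the complement of the support is a second
    open set, where u is 0, and the two cover the space.\<close>
  then have "continuous_on (S \<union> - support u) u"
    using 1 2 assms(2) by (intro continuous_on_open_Un)
  moreover have "S \<union> - support u = UNIV" using s by blast
  ultimately show ?thesis by simp
qed

lemma closed_singular_set:
  "closed (singular_set :: ('a::real_normed_vector \<times> 'b::real_normed_vector) set)"
  unfolding singular_set_def by (intro closed_Collect_eq continuous_intros)

text \<open>The compact support avoids the singular set, so the integrand is bounded there and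
  vanishes elsewhere. Finiteness is what makes the absorption legitimate.\<close>

lemma C1c_hardy_integral_finite:
  fixes u :: "'a::euclidean_space \<times> 'b::euclidean_space \<Rightarrow> real"
  assumes "u \<in> C1c (- singular_set)" "p > 0"
  shows "(\<integral>\<^sup>+ x. ennreal (\<bar>u x\<bar> powr p * norm (fst x) powr - g) \<partial>lborel) < \<infinity>"
proof -
  let ?f = "\<lambda>x. \<bar>u x\<bar> powr p * norm (fst x) powr - g"
  have s: "compact (support u)" "support u \<subseteq> - singular_set"
    using assms unfolding C1c_def by auto
  have "continuous_on (support u) u"
    using C1c_imp_continuous_on[OF assms(1)] closed_singular_set
    by (meson continuous_on_subset open_Compl subset_UNIV)
  \<comment> \<open>The base \<open>\<bar>u x\<bar>\<close> may vanish, so its power is continuous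
    because p > 0; the other base is nonzero on the support.\<close>
  then have "continuous_on (support u) ?f"
    using s(2) assms(2) by (intro continuous_intros continuous_on_powr') (auto simp: singular_set_def)
  then have "bounded (?f ` support u)"
    using s(1) compact_continuous_image compact_imp_bounded by blast
  then obtain M where M: "\<And>x. x \<in> support u \<Longrightarrow> ?f x \<le> M"
    unfolding bounded_iff by fastforce
  have "(\<integral>\<^sup>+ x. ennreal (?f x) \<partial>lborel) \<le> (\<integral>\<^sup>+ x. ennreal M * indicator (support u) x \<partial>lborel)"
  proof (intro nn_integral_mono)
    fix x
    have "u x = 0" if "x \<notin> support u"
      using that closure_subset[of "{x. u x \<noteq> 0}"] unfolding support_def by blast
    then show "ennreal (?f x) \<le> ennreal M * indicator (support u) x"
      using M[of x] by (auto simp: indicator_def intro!: ennreal_leI)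
  qed
  also have "\<dots> = ennreal M * emeasure lborel (support u)"
    using s(1) by (intro nn_integral_cmult_indicator) (auto simp: compact_imp_closed)
  also have "\<dots> < \<infinity>"
    using s(1) emeasure_compact_finite by (auto simp: ennreal_mult_less_top)
  finally show ?thesis .
qed

section \<open>The comparison inequality, absorption and the choice of \<open>l\<close>\<close>

text \<open>Both multiples of \<open>H\<close> come from the double integral of the kernel times
  \<open>\<bar>u x\<bar> powr p\<close>. Integrating in y first gives the left hand side exactly;
  after Tonelli and \<open>abs_powr_le_diff\<close>, integrating the
  \<open>\<bar>u y\<bar> powr p\<close> part in x first gives the last term.\<close>

lemma hardy_comparison:
  fixes u :: "'a::euclidean_space \<times> 'b::euclidean_space \<Rightarrow> real"
  assumes u: "u \<in> borel_measurable borel" "\<And>x. fst x = 0 \<Longrightarrow> u x = 0"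
    and "l > 0" "p > 0" "g > 0"
  defines "v \<equiv> unit_ball_vol (real DIM('a)) * unit_ball_vol (real DIM('b))"
    and "H \<equiv> \<integral>\<^sup>+ x. ennreal (\<bar>u x\<bar> powr p * norm (fst x) powr - g) \<partial>lborel"
  shows "ennreal (v * (2 ^ DIM('a) - 1) * l ^ DIM('a)) * H \<le>
    ennreal (2 powr p) * (\<integral>\<^sup>+ y. \<integral>\<^sup>+ x. ennreal (comparison_kernel l g x y *
      \<bar>u x - u y\<bar> powr p) \<partial>lborel \<partial>lborel) +
    ennreal (2 powr p * (v * 2 powr (g + real DIM('a \<times> 'b)) * l powr g)) * H"
proof -
  note [measurable] = u(1)
  let ?k = "comparison_kernel l g"
  let ?c = "ennreal (v * (2 ^ DIM('a) - 1) * l ^ DIM('a))"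
  let ?e = "ennreal (v * 2 powr (g + real DIM('a \<times> 'b)) * l powr g)"
  have [measurable]: "(\<lambda>(x, y). ?k x y) \<in> borel_measurable (borel \<Otimes>\<^sub>M borel)"
    "\<And>y. (\<lambda>x. ?k x y) \<in> borel_measurable borel"
    "\<And>x. (\<lambda>y. ?k x y) \<in> borel_measurable borel"
  proof -
    show "(\<lambda>(x, y). ?k x y) \<in> borel_measurable (borel \<Otimes>\<^sub>M borel)"
      using comparison_kernel_measurable[of l g] by (simp add: case_prod_beta)
    then show "(\<lambda>x. ?k x y) \<in> borel_measurable borel" "(\<lambda>y'. ?k y y') \<in> borel_measurable borel"
      for y by measurable
  qed
  have "?c * H = (\<integral>\<^sup>+ x. ?c * ennreal (\<bar>u x\<bar> powr p * norm (fst x) powr - g) \<partial>lborel)"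
    unfolding H_def by (intro nn_integral_cmult[symmetric]) measurable
  also have "\<dots> = (\<integral>\<^sup>+ x. \<integral>\<^sup>+ y. ennreal (?k x y * \<bar>u x\<bar> powr p) \<partial>lborel \<partial>lborel)"
  proof (intro nn_integral_cong)
    fix x
    have "(\<integral>\<^sup>+ y. ennreal (?k x y * \<bar>u x\<bar> powr p) \<partial>lborel) =
        (\<integral>\<^sup>+ y. ennreal (?k x y) \<partial>lborel) * ennreal (\<bar>u x\<bar> powr p)"
      by (subst nn_integral_multc[symmetric])
        (auto simp: ennreal_mult comparison_kernel_nonneg)
    \<comment> \<open>The kernel integral is computed for \<open>fst x \<noteq> 0\<close>; at the
      remaining points u vanishes and both sides are 0.\<close>
    then show "?c * ennreal (\<bar>u x\<bar> powr p * norm (fst x) powr - g) =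
        (\<integral>\<^sup>+ y. ennreal (?k x y * \<bar>u x\<bar> powr p) \<partial>lborel)"
      using u(2)[of x] assms(3,4)
      by (cases "fst x = 0") (auto simp: nn_integral_comparison_kernel v_def ennreal_mult mult_ac)
  qed
  also have "\<dots> = (\<integral>\<^sup>+ y. \<integral>\<^sup>+ x. ennreal (?k x y * \<bar>u x\<bar> powr p) \<partial>lborel \<partial>lborel)"
    by (intro lborel_pair.Fubini'[symmetric]) measurable
  also have "\<dots> \<le> (\<integral>\<^sup>+ y. ennreal (2 powr p) *
        (\<integral>\<^sup>+ x. ennreal (?k x y * \<bar>u x - u y\<bar> powr p) \<partial>lborel) +
        ennreal (2 powr p) * (?e * ennreal (\<bar>u y\<bar> powr p * norm (fst y) powr - g)) \<partial>lborel)"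
  proof (intro nn_integral_mono)
    fix y
    have "(\<integral>\<^sup>+ x. ennreal (?k x y * \<bar>u x\<bar> powr p) \<partial>lborel) \<le>
      (\<integral>\<^sup>+ x. ennreal (2 powr p) * ennreal (?k x y * \<bar>u x - u y\<bar> powr p) +
        ennreal (2 powr p) * (ennreal (?k x y) * ennreal (\<bar>u y\<bar> powr p)) \<partial>lborel)"
    proof (intro nn_integral_mono)
      fix x
      have "?k x y * \<bar>u x\<bar> powr p \<le>
          ?k x y * (2 powr p * (\<bar>u x - u y\<bar> powr p + \<bar>u y\<bar> powr p))"
        using assms by (intro mult_left_mono abs_powr_le_diff comparison_kernel_nonneg) auto
      also have "\<dots> = 2 powr p * (?k x y * \<bar>u x - u y\<bar> powr p) +
          2 powr p * (?k x y * \<bar>u y\<bar> powr p)"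
        by (simp add: algebra_simps)
      finally show "ennreal (?k x y * \<bar>u x\<bar> powr p) \<le>
          ennreal (2 powr p) * ennreal (?k x y * \<bar>u x - u y\<bar> powr p) +
          ennreal (2 powr p) * (ennreal (?k x y) * ennreal (\<bar>u y\<bar> powr p))"
        by (simp add: comparison_kernel_nonneg ennreal_leI flip: ennreal_mult ennreal_plus)
    qed
    also have "\<dots> = ennreal (2 powr p) * (\<integral>\<^sup>+ x. ennreal (?k x y * \<bar>u x - u y\<bar> powr p) \<partial>lborel) +
        ennreal (2 powr p) * ((\<integral>\<^sup>+ x. ennreal (?k x y) \<partial>lborel) * ennreal (\<bar>u y\<bar> powr p))"
      by (subst nn_integral_add, simp, simp, subst (1 2) nn_integral_cmult, simp, simp)
        (simp add: nn_integral_multc)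
    also have "\<dots> \<le> ennreal (2 powr p) *
        (\<integral>\<^sup>+ x. ennreal (?k x y * \<bar>u x - u y\<bar> powr p) \<partial>lborel) +
        ennreal (2 powr p) * ((?e * ennreal (norm (fst y) powr - g)) * ennreal (\<bar>u y\<bar> powr p))"
      unfolding v_def using assms(3,5)
      by (intro add_left_mono mult_left_mono mult_right_mono
          nn_integral_comparison_kernel_dual_le) auto
    finally show "(\<integral>\<^sup>+ x. ennreal (?k x y * \<bar>u x\<bar> powr p) \<partial>lborel) \<le>
        ennreal (2 powr p) * (\<integral>\<^sup>+ x. ennreal (?k x y * \<bar>u x - u y\<bar> powr p) \<partial>lborel) +
        ennreal (2 powr p) * (?e * ennreal (\<bar>u y\<bar> powr p * norm (fst y) powr - g))"
      by (simp add: ennreal_mult mult_ac)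
  qed
  also have "\<dots> = ennreal (2 powr p) * (\<integral>\<^sup>+ y. \<integral>\<^sup>+ x. ennreal (?k x y *
      \<bar>u x - u y\<bar> powr p) \<partial>lborel \<partial>lborel) + ennreal (2 powr p) * (?e * H)"
  proof -
    have [measurable]: "(\<lambda>y. \<integral>\<^sup>+ x. ennreal (?k x y * \<bar>u x - u y\<bar> powr p) \<partial>lborel)
        \<in> borel_measurable borel"
      by measurable
    show ?thesis
      unfolding H_def by (simp add: nn_integral_add nn_integral_cmult)
  qed
  also have "ennreal (2 powr p) * (?e * H) =
      ennreal (2 powr p * (v * 2 powr (g + real DIM('a \<times> 'b)) * l powr g)) * H"
    by (simp add: ennreal_mult v_def mult_ac)
  finally show ?thesis .
qed

text \<open>Finiteness of \<open>H\<close> allows the subtraction of the last term, and c - e is at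
  least c/2. For infinite \<open>G\<close> the bound is trivial.\<close>

lemma ennreal_absorb:
  fixes H G :: ennreal and c e :: real
  assumes "ennreal c * H \<le> G + ennreal e * H" "H < \<infinity>" "0 \<le> e" "2 * e \<le> c" "c > 0"
  shows "H \<le> ennreal (2 / c) * G"
proof (cases "G = \<infinity>")
  case True
  with assms show ?thesis by (simp add: ennreal_mult_top)
next
  case False
  obtain h where h: "H = ennreal h" "h \<ge> 0"
    using assms(2) by (cases H) auto
  obtain a where a: "G = ennreal a" "a \<ge> 0"
    using False by (cases G) auto
  have "c * h \<le> a + e * h"
    using assms h a by (simp flip: ennreal_mult ennreal_plus)
  moreover have "2 * e * h \<le> c * h"
    using assms h by (intro mult_right_mono) auto
  ultimately have "c * h \<le> 2 * a" by linarith
  then have "h \<le> 2 / c * a"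
    using assms by (simp add: field_simps)
  then show ?thesis
    using h a assms by (simp add: ennreal_leI flip: ennreal_mult)
qed

text \<open>The ratio e/c is at most a constant times \<open>l\<close> to the power g - k, so it can
  be made at most 1/2: with \<open>l\<close> large if g < k and small if g > k.\<close>

lemma fractional_hardy_prod:
  fixes p t \<alpha> \<beta> :: real
  assumes "p > 0" "t > 0" "t - \<alpha> - \<beta> > 0" "t - \<alpha> - \<beta> \<noteq> real DIM('a::euclidean_space)"
  shows "\<exists>C::real. C > 0 \<and> (\<forall>u \<in> C1c (- (singular_set :: ('a \<times> 'b::euclidean_space) set)).
    (\<integral>\<^sup>+ x. ennreal (\<bar>u x\<bar> powr p * norm (fst x) powr - (t - \<alpha> - \<beta>)) \<partial>lborel) \<le> ennreal C *
      (\<integral>\<^sup>+ y. \<integral>\<^sup>+ x. ennreal (\<bar>u x - u y\<bar> powr p / norm (x - y) powr (real DIM('a \<times> 'b) + t) *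
        norm (fst x) powr \<alpha> * norm (fst y) powr \<beta>) \<partial>lborel \<partial>lborel))"
proof -
  define g where "g = t - \<alpha> - \<beta>"
  define k where "k = DIM('a)"
  define n where "n = DIM('a \<times> 'b)"
  define v where "v = unit_ball_vol (real DIM('a)) * unit_ball_vol (real DIM('b))"
  \<comment> \<open>This collects the powers of 2 in \<open>e\<close>, with one more for the factor
    2 in \<open>2 * e \<le> c\<close>.\<close>
  define q where "q = p + g + real n + 1"
  \<comment> \<open>chosen so that \<open>2 powr q * l powr (g - k) = 1\<close>\<close>
  define l where "l = 2 powr (q / (real k - g))"
  define B where "B = (2 + 2 * l) powr (real n + t) / min (l powr \<beta>) ((2 * l) powr \<beta>)"
  define c where "c = v * (2 ^ k - 1) * l ^ k"
  define e where "e = 2 powr p * (v * 2 powr (g + real n) * l powr g)"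
  have g: "g > 0" "g \<noteq> real k" using assms by (auto simp: g_def k_def)
  have l: "l > 0" by (simp add: l_def)
  have v: "v > 0" by (simp add: v_def)
  \<comment> \<open>As k is at least 1, the annulus factor \<open>2 ^ k - 1\<close> is at least 1,
    so \<open>c\<close> is at least \<open>v * l ^ k\<close>.\<close>
  have two: "(2::real) ^ k \<ge> 2"
    using power_increasing[of 1 k "2::real"] by (simp add: k_def DIM_positive Suc_le_eq)
  have c: "c > 0" using v l two by (simp add: c_def)
  have e: "e \<ge> 0" using v by (simp add: e_def)
  have B: "B > 0" using l by (auto simp: B_def)
  have "2 powr q * l powr g = l powr real k"
  proof -
    \<comment> \<open>This compares exponents of 2; dividing by k - g uses g \<noteq> k.\<close>
    have "q + q / (real k - g) * g = q / (real k - g) * real k"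
      using g by (simp add: field_simps)
    then show ?thesis
      by (simp add: l_def powr_powr flip: powr_add)
  qed
  then have "2 * e = v * l ^ k"
    using l by (simp add: e_def q_def powr_add powr_realpow mult_ac)
  also have "\<dots> \<le> c"
    using v l two by (simp add: c_def mult_left_mono mult_right_mono)
  finally have ec: "2 * e \<le> c" .
  show ?thesis
  proof (intro exI[of _ "2 / c * (2 powr p * B)"] conjI ballI)
    show "2 / c * (2 powr p * B) > 0" using c B by simp
    fix u :: "'a \<times> 'b \<Rightarrow> real" assume u: "u \<in> C1c (- singular_set)"
    define H where "H = (\<integral>\<^sup>+ x. ennreal (\<bar>u x\<bar> powr p * norm (fst x) powr - g) \<partial>lborel)"
    let ?F = "\<lambda>x y. \<bar>u x - u y\<bar> powr p / norm (x - y) powr (real n + t) *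
        norm (fst x) powr \<alpha> * norm (fst y) powr \<beta>"
    let ?G = "\<integral>\<^sup>+ y. \<integral>\<^sup>+ x. ennreal (?F x y) \<partial>lborel \<partial>lborel"
    have "continuous_on UNIV u"
      using C1c_imp_continuous_on[OF u] closed_singular_set open_Compl by blast
    then have um[measurable]: "u \<in> borel_measurable borel"
      by (rule borel_measurable_continuous_onI)
    have "u x = 0" if "fst x = 0" for x
      using that u closure_subset[of "{x. u x \<noteq> 0}"]
      by (auto simp: C1c_def support_def singular_set_def)
    from hardy_comparison[OF um this l assms(1) g(1)]
    have "ennreal c * H \<le> ennreal (2 powr p) * (\<integral>\<^sup>+ y. \<integral>\<^sup>+ x. ennreal (comparison_kernel l g x y *
        \<bar>u x - u y\<bar> powr p) \<partial>lborel \<partial>lborel) + ennreal e * H"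
      by (simp add: c_def e_def H_def v_def k_def n_def)
    also have "(\<integral>\<^sup>+ y. \<integral>\<^sup>+ x. ennreal (comparison_kernel l g x y * \<bar>u x - u y\<bar> powr p) \<partial>lborel \<partial>lborel)
        \<le> (\<integral>\<^sup>+ y. \<integral>\<^sup>+ x. ennreal B * ennreal (?F x y) \<partial>lborel \<partial>lborel)"
    proof (intro nn_integral_mono)
      fix y x
      show "ennreal (comparison_kernel l g x y * \<bar>u x - u y\<bar> powr p) \<le> ennreal B * ennreal (?F x y)"
        using comparison_kernel_le_gagliardo[OF l assms(2), of \<alpha> \<beta> x y u p] B
        unfolding B_def g_def n_def by (simp add: ennreal_leI flip: ennreal_mult)
    qed
    also have "(\<integral>\<^sup>+ y. \<integral>\<^sup>+ x. ennreal B * ennreal (?F x y) \<partial>lborel \<partial>lborel) = ennreal B * ?G"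
      by (subst nn_integral_cmult[symmetric], simp, subst nn_integral_cmult, simp_all)
    finally have "ennreal c * H \<le> ennreal (2 powr p) * (ennreal B * ?G) + ennreal e * H"
      by (simp add: mult_left_mono add_right_mono)
    \<comment> \<open>Absorption applies since \<open>H\<close> is finite for the given u and
      \<open>2 * e \<le> c\<close>.\<close>
    then have "H \<le> ennreal (2 / c) * (ennreal (2 powr p) * (ennreal B * ?G))"
      using C1c_hardy_integral_finite[OF u assms(1), of g] e ec c
      by (intro ennreal_absorb) (auto simp: H_def)
    also have "\<dots> = ennreal (2 / c * (2 powr p * B)) * ?G"
      proof -
      have "2 / c \<ge> 0" "2 powr p * B \<ge> 0" using c B by auto
      then show ?thesis by (simp only: ennreal_mult' powr_ge_zero mult.assoc)
    qed
    finally show "(\<integral>\<^sup>+ x. ennreal (\<bar>u x\<bar> powr p * norm (fst x) powr - (t - \<alpha> - \<beta>)) \<partial>lborel) \<le>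
      ennreal (2 / c * (2 powr p * B)) *
      (\<integral>\<^sup>+ y. \<integral>\<^sup>+ x. ennreal (\<bar>u x - u y\<bar> powr p / norm (x - y) powr (real DIM('a \<times> 'b) + t) *
        norm (fst x) powr \<alpha> * norm (fst y) powr \<beta>) \<partial>lborel \<partial>lborel)"
      unfolding H_def g_def n_def .
  qed
qed

theorem theorem1:
  fixes d k :: nat and p s \<alpha> \<beta> :: real
  assumes "d \<ge> 3" and "p > 1" and "0 < s" and "s < 1"
    and "1 < k" and "k < d"
    and "CARD('k::finite) = k" and "CARD('m::finite) = d - k"
    and "s * p - \<alpha> - \<beta> > 0" and "s * p \<noteq> real k + \<alpha> + \<beta>"
  shows "\<exists>C::real. C > 0 \<and>
    (\<forall>u \<in> C1c (- (singular_set :: ((real ^ 'k) \<times> (real ^ 'm)) set)).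
      (\<integral>\<^sup>+ x. ennreal (\<bar>u x\<bar> powr p / norm (fst x) powr (s * p - \<alpha> - \<beta>)) \<partial>lborel)
      \<le> ennreal C *
        (\<integral>\<^sup>+ y. (\<integral>\<^sup>+ x. ennreal (\<bar>u x - u y\<bar> powr p / norm (x - y) powr (real d + s * p)
            * norm (fst x) powr \<alpha> * norm (fst y) powr \<beta>) \<partial>lborel) \<partial>lborel))"
proof -
  have "DIM((real ^ 'k) \<times> (real ^ 'm)) = d"
    using assms by simp
  \<comment> \<open>The identity also holds at r = 0, where both sides are 0 by the conventions for
    \<open>powr\<close> and division.\<close>
  moreover have "\<bar>a\<bar> powr p * r powr - (s * p - \<alpha> - \<beta>) = \<bar>a\<bar> powr p / r powr (s * p - \<alpha> - \<beta>)"
    for a r :: real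
    by (simp only: powr_minus divide_inverse)
  moreover have "s * p - \<alpha> - \<beta> \<noteq> real DIM(real ^ 'k)"
    using assms by simp
  ultimately show ?thesis
    using fractional_hardy_prod[of p "s * p" \<alpha> \<beta>, where 'a = "real ^ 'k" and 'b = "real ^ 'm"] assms
    by (simp only:) simp
qed

end
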